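(* The set $\mathbb H_\mu$ is connected but not open in $\mathbb C^4$. Also, if $(x_1,x_2,x_1x_2)\in\mathbb E$, then $(0,x_1,x_2,x_1x_2)$ is not an interior point of $\mathbb H_\mu$.
   Context: $\overline{\mathbb D}$ is the closed unit disc in $\mathbb C$; $\|\cdot\|$ is the operator norm on $M_2(\mathbb C)$ induced by the Euclidean norm on $\mathbb C^2$. Let $E\subset M_2(\mathbb C)$ be the linear space of all upper triangular matrices. For $A\in M_2(\mathbb C)$, $$\mu_{\mathrm{hexa}}(A)=\frac{1}{\inf\{\|X\| : X\in E,\ \det(I-AX)=0\}},$$ with $\mu_{\mathrm{hexa}}(A)=0$ if $\det(I-AX)\ne0$ for all $X\in E$. $\pi:M_2(\mathbb C)\to\mathbb C^4$ is $\pi((a_{ij}))=(a_{21},a_{11},a_{22},\det(A))$, and the $\mu$-hexablock is $\mathbb H_\mu=\{\pi(A): A\in M_2(\mathbb C),\ \mu_{\mathrm{hexa}}(A)<1\}$. The tetrablock is $\mathbb E=\{(x_1,x_2,x_3)\in\mathbb C^3: 1-x_1z_1-x_2z_2+x_3z_1z_2\ne0 \text{ for all } z_1,z_2\in\overline{\mathbb D}\}$. *)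

theory Defs
  imports "HOL-Analysis.Analysis"
begin

text \<open>The norm of \<open>complex^2\<close> is the Euclidean norm, so this is the operator norm it induces.\<close>

definition op_norm :: "complex^2^2 \<Rightarrow> real" where
  "op_norm X = onorm (\<lambda>v. X *v v)"

definition upper_triangular_matrices :: "(complex^2^2) set" where
  "upper_triangular_matrices = {X. X $ 2 $ 1 = 0}"

definition mu_hexa :: "complex^2^2 \<Rightarrow> real" where
  "mu_hexa A =
    (if \<forall>X\<in>upper_triangular_matrices. det (mat 1 - A ** X) \<noteq> 0 then 0
     else 1 / Inf {op_norm X | X. X \<in> upper_triangular_matrices \<and> det (mat 1 - A ** X) = 0})"

definition hexa_proj :: "complex^2^2 \<Rightarrow> complex^4" where
  "hexa_proj A = vector [A $ 2 $ 1, A $ 1 $ 1, A $ 2 $ 2, det A]"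

definition mu_hexablock :: "(complex^4) set" where
  "mu_hexablock = {hexa_proj A | A. mu_hexa A < 1}"

definition tetrablock :: "(complex^3) set" where
  "tetrablock = {x. \<forall>z1\<in>cball 0 1. \<forall>z2\<in>cball 0 1.
     1 - x $ 1 * z1 - x $ 2 * z2 + x $ 3 * z1 * z2 \<noteq> 0}"

end

theory Submission
  imports Defs
begin

text \<open>
  The interior of the block misses the whole hyperplane where the first coordinate is \<open>0\<close>: that
  coordinate is the entry \<open>A $ 2 $ 1\<close>, and when it vanishes \<open>A\<close> is triangular, so the last coordinate
  \<open>det A\<close> is forced to be the product of the two middle ones. Hence moving the last coordinate alone
  leaves the block at once (lemma \<open>not_interior_mu_hexablock\<close>). The block contains the origin, so it
  cannot be open.

  Connectedness holds because the block is the continuous image of \<open>{A. mu_hexa A < 1}\<close>, and this set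
  is star-shaped about the zero matrix: if \<open>X\<close> makes \<open>I - (t A) X\<close> singular, then \<open>t X\<close>, which is
  upper triangular too and no larger than \<open>X\<close> for \<open>0 \<le> t \<le> 1\<close>, makes \<open>I - A (t X)\<close> singular.
\<close>

definition singularising_norms :: "complex^2^2 \<Rightarrow> real set" where
  "singularising_norms A =
    {op_norm X | X. X \<in> upper_triangular_matrices \<and> det (mat 1 - A ** X) = 0}"

lemma mu_hexa_eq:
  "mu_hexa A = (if singularising_norms A = {} then 0 else 1 / Inf (singularising_norms A))"
  unfolding mu_hexa_def singularising_norms_def by auto

lemma bounded_linear_matrix_vector_mult: "bounded_linear (\<lambda>v. X *v v)"
  for X :: "complex^2^2"
  by (rule matrix_vector_mul_bounded_linear)

lemma op_norm_nonneg: "0 \<le> op_norm X"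
  unfolding op_norm_def by (rule onorm_pos_le[OF bounded_linear_matrix_vector_mult])

lemma norm_matrix_vector_mult_le: "norm (X *v v) \<le> op_norm X * norm v"
  unfolding op_norm_def by (rule onorm[OF bounded_linear_matrix_vector_mult])

lemma op_norm_scaleR: "op_norm (t *\<^sub>R X) = \<bar>t\<bar> * op_norm X"
proof -
  have "(\<lambda>v. (t *\<^sub>R X) *v v) = (\<lambda>v. t *\<^sub>R (X *v v))"
    by (simp add: fun_eq_iff vec_eq_iff matrix_vector_mult_def scaleR_sum_right)
  then show ?thesis
    unfolding op_norm_def by (simp only: onorm_scaleR[OF bounded_linear_matrix_vector_mult])
qed

lemma kernel_vector_if_det_eq_0:
  fixes M :: "complex^2^2"
  assumes "det M = 0"
  obtains v where "v \<noteq> 0" "M *v v = 0"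
  using assms by (metis invertible_det_nz invertible_left_inverse matrix_left_invertible_ker)

text \<open>A vector \<open>v\<close> in the kernel of \<open>I - A X\<close> satisfies \<open>v = A X v\<close>, which bounds \<open>op_norm X\<close> from
  below by the reciprocal of \<open>op_norm A\<close>. This keeps the infimum in \<open>mu_hexa\<close> away from \<open>0\<close>, where
  the convention \<open>1 / 0 = 0\<close> would otherwise give a meaningless value.\<close>

lemma one_le_op_norm_mult_if_singular:
  assumes "det (mat 1 - A ** X) = 0"
  shows "1 \<le> op_norm A * op_norm X"
proof -
  obtain v where "v \<noteq> 0" and "(mat 1 - A ** X) *v v = 0"
    using kernel_vector_if_det_eq_0[OF assms] .
  then have "v = A *v (X *v v)"
    by (simp add: matrix_vector_mult_diff_rdistrib matrix_vector_mul_assoc)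
  then have "norm v \<le> op_norm A * norm (X *v v)"
    using norm_matrix_vector_mult_le by metis
  also have "\<dots> \<le> op_norm A * (op_norm X * norm v)"
    by (intro mult_left_mono norm_matrix_vector_mult_le op_norm_nonneg)
  finally show ?thesis
    using \<open>v \<noteq> 0\<close> by (simp flip: mult.assoc)
qed

lemma bdd_below_singularising_norms: "bdd_below (singularising_norms A)"
  unfolding singularising_norms_def by (auto intro!: bdd_belowI[of _ 0] op_norm_nonneg)

lemma Inf_singularising_norms_pos:
  assumes "singularising_norms A \<noteq> {}"
  shows "0 < Inf (singularising_norms A)"
proof -
  have bound: "1 \<le> op_norm A * r" if "r \<in> singularising_norms A" for r
    using that one_le_op_norm_mult_if_singular unfolding singularising_norms_def by auto
  then have "op_norm A \<noteq> 0"
    using assms by fastforce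
  then have pos: "0 < op_norm A"
    using op_norm_nonneg[of A] by simp
  have "1 / op_norm A \<le> Inf (singularising_norms A)"
    using assms bound pos by (intro cInf_greatest) (auto simp: field_simps)
  then show ?thesis
    using pos by (meson less_le_trans zero_less_divide_1_iff)
qed

text \<open>A uniform lower bound above \<open>1\<close> covers at once the case where no \<open>X\<close> makes \<open>I - A X\<close> singular,
  and it passes from \<open>A\<close> to \<open>t A\<close> for \<open>0 \<le> t \<le> 1\<close> without comparing infima.\<close>

lemma mu_hexa_less_1_iff:
  "mu_hexa A < 1 \<longleftrightarrow> (\<exists>c>1. \<forall>r\<in>singularising_norms A. c \<le> r)"
proof (cases "singularising_norms A = {}")
  case True
  then show ?thesis
    by (auto simp: mu_hexa_eq intro: exI[of _ 2])
next
  case False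
  then have "mu_hexa A < 1 \<longleftrightarrow> 1 < Inf (singularising_norms A)"
    using Inf_singularising_norms_pos[OF False] by (simp add: mu_hexa_eq)
  also have "\<dots> \<longleftrightarrow> (\<exists>c>1. \<forall>r\<in>singularising_norms A. c \<le> r)"
    using False bdd_below_singularising_norms
    by (meson cInf_greatest cInf_lower less_le_trans)
  finally show ?thesis .
qed

lemma mu_hexa_scaleR_less_1:
  assumes "mu_hexa A < 1" and t: "0 \<le> t" "t \<le> 1"
  shows "mu_hexa (t *\<^sub>R A) < 1"
proof -
  obtain c where "c > 1" and c: "\<And>r. r \<in> singularising_norms A \<Longrightarrow> c \<le> r"
    using assms(1) mu_hexa_less_1_iff by auto
  have "c \<le> r" if r: "r \<in> singularising_norms (t *\<^sub>R A)" for r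
  proof -
    obtain X where X: "r = op_norm X" "X \<in> upper_triangular_matrices"
      "det (mat 1 - (t *\<^sub>R A) ** X) = 0"
      using r unfolding singularising_norms_def by auto
    have "(t *\<^sub>R A) ** X = A ** (t *\<^sub>R X)"
      by (simp add: matrix_matrix_mult_def vec_eq_iff)
    then have "op_norm (t *\<^sub>R X) \<in> singularising_norms A"
      using X unfolding singularising_norms_def upper_triangular_matrices_def by auto
    then have "c \<le> t * op_norm X"
      using c t(1) by (fastforce simp: op_norm_scaleR)
    also have "\<dots> \<le> op_norm X"
      using t op_norm_nonneg[of X] by (simp add: mult_left_le_one_le)
    finally show ?thesis
      using X(1) by simp
  qed
  then show ?thesis
    using \<open>c > 1\<close> mu_hexa_less_1_iff by blast
qed

lemma mu_hexa_0: "mu_hexa 0 = 0"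
  by (simp add: mu_hexa_def)

lemma connected_mu_hexa_less_1: "connected {A. mu_hexa A < 1}"
proof (rule starlike_imp_connected)
  show "starlike {A. mu_hexa A < 1}"
    unfolding starlike_def
    by (rule bexI[of _ 0]) (auto simp: closed_segment_def mu_hexa_0 intro!: mu_hexa_scaleR_less_1)
qed

lemma vector_4_nth:
  fixes a b c d :: "'a::zero"
  shows "vector [a, b, c, d] $ (1::4) = a" "vector [a, b, c, d] $ (2::4) = b"
    "vector [a, b, c, d] $ (3::4) = c" "vector [a, b, c, d] $ (4::4) = d"
  by (simp_all add: vector_def)

lemma continuous_on_hexa_proj: "continuous_on S hexa_proj"
proof -
  have "continuous_on S (\<lambda>A. hexa_proj A $ i)" for i
  proof -
    have "\<forall>i. continuous_on S (\<lambda>A. hexa_proj A $ i)"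
      by (simp add: forall_4 hexa_proj_def vector_4_nth det_2 continuous_intros)
    then show ?thesis ..
  qed
  then have "continuous_on S (\<lambda>A. \<chi> i. hexa_proj A $ i)"
    by (rule continuous_on_vec_lambda)
  then show ?thesis
    by simp
qed

lemma mu_hexablock_eq_image: "mu_hexablock = hexa_proj ` {A. mu_hexa A < 1}"
  unfolding mu_hexablock_def by blast

lemma zero_in_mu_hexablock: "0 \<in> mu_hexablock"
proof -
  have "hexa_proj 0 = 0"
    by (simp add: hexa_proj_def vec_eq_iff forall_4 vector_4_nth det_2)
  then show ?thesis
    unfolding mu_hexablock_eq_image using mu_hexa_0 by force
qed

lemma mu_hexablock_nth_4_if_nth_1_eq_0:
  assumes "x \<in> mu_hexablock" "x $ 1 = 0"
  shows "x $ 4 = x $ 2 * x $ 3"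
  using assms by (auto simp: mu_hexablock_def hexa_proj_def vector_4_nth det_2)

text \<open>The open ball around \<open>x\<close> contains a point that differs from \<open>x\<close> in the last coordinate alone,
  so it breaks the relation of the previous lemma, which \<open>x\<close> itself satisfies.\<close>

lemma not_interior_mu_hexablock:
  assumes "x $ 1 = 0"
  shows "x \<notin> interior mu_hexablock"
proof
  assume x: "x \<in> interior mu_hexablock"
  then obtain e where "e > 0" and ball: "ball x e \<subseteq> mu_hexablock"
    by (meson mem_interior)
  define y where "y = x + (e / 2) *\<^sub>R axis 4 1"
  have "dist x y < e"
    using \<open>e > 0\<close> norm_Basis[OF axis_in_Basis_iff[THEN iffD2]]
    by (simp add: y_def dist_norm Basis_complex_def)
  then have "y \<in> mu_hexablock"
    using ball by auto
  moreover have "x \<in> mu_hexablock"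
    using x interior_subset by auto
  ultimately show False
    using mu_hexablock_nth_4_if_nth_1_eq_0[of x] mu_hexablock_nth_4_if_nth_1_eq_0[of y] assms \<open>e > 0\<close>
    by (simp add: y_def axis_def)
qed

theorem proposition3p9:
  shows "connected mu_hexablock \<and> \<not> open mu_hexablock \<and>
    (\<forall>x1 x2 :: complex. vector [x1, x2, x1 * x2] \<in> tetrablock \<longrightarrow>
      vector [0, x1, x2, x1 * x2] \<notin> interior mu_hexablock)"
proof (intro conjI allI impI)
  show "connected mu_hexablock"
    unfolding mu_hexablock_eq_image
    by (rule connected_continuous_image[OF continuous_on_hexa_proj connected_mu_hexa_less_1])
  show "\<not> open mu_hexablock"
    using zero_in_mu_hexablock not_interior_mu_hexablock[of 0] by (auto simp: interior_open)
  show "vector [0, x1, x2, x1 * x2] \<notin> interior mu_hexablock" for x1 x2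
    by (rule not_interior_mu_hexablock) (simp add: vector_4_nth)
qed

end
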